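(* If the XOR-clause-set $F$ is acyclic, then $X_1(F)$ is an absolute forcing representation of $F$.
   Context: Clauses are finite sets of literals without complementary pairs ($\bot$ empty clause), clause-sets finite sets of clauses read as CNF ($\top$ empty clause-set); $\varphi*F$ applies a partial assignment. A literal $x$ is forced for $F$ if $\langle x\to0\rangle*F$ is unsatisfiable. $r_1$ is unit-clause propagation. For a variable set $V$, $\mathrm{phd}^V(F)\le 1$ means: for every partial $\varphi$ with $\mathrm{var}(\varphi)\subseteq V$, if $\varphi*F$ is unsatisfiable then $r_1(\varphi*F)=\{\bot\}$, and otherwise $r_1(\varphi*F)$ has no forced literal with variable in $V$; $F\in\mathcal{PC}$ means $\mathrm{phd}^{\mathrm{var}(F)}(F)\le1$. An XOR-clause $C$ denotes $\bigoplus_{x\in C}x=0$ over $\mathbb{Z}_2$; an XOR-clause-set is a conjunction of such. $F$ is acyclic if the bipartite graph with parts $\mathrm{var}(F)$ and $F$, with $v$ adjacent to $C$ iff $v\in\mathrm{var}(C)$, has no cycle. $X_0(C)$: all clauses $D$ with $\mathrm{var}(D)=\mathrm{var}(C)$ whose number of complemented literals has parity different from that in $C$. Natural splitting of $C=\{x_1,\dots,x_n\}$ (in some order): $\{C\}$ if $n\le2$, else the XOR-clauses $\{x_1,x_2,y_2\}$, $\{y_{i-1},x_i,y_i\}$ ($3\le i\le n-1$), $\{y_{n-1},x_n\}$ with new variables $y_j$; $X_1(C)=\bigcup X_0$ of these; $X_1(F)=\bigcup_{C\in F}X_1(C)$ with new variables for distinct clauses pairwise disjoint. A CNF-representation of $F$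 is a clause-set $F'$ with $\mathrm{var}(F)\subseteq\mathrm{var}(F')$ such that for every total assignment $\varphi$ of $\mathrm{var}(F)$, $\varphi*F'$ is satisfiable iff $\varphi$ satisfies $F$. It is forcing if $\mathrm{phd}^{\mathrm{var}(F)}(F')\le1$ and $r_1(\varphi*F')=\top$ for every total $\varphi$ of $\mathrm{var}(F)$ with $\varphi*F'$ satisfiable; absolute forcing if additionally $F'\in\mathcal{PC}$. *)

theory Defs
  imports Main "HOL-Library.Z2"
begin

datatype 'v lit = Pos 'v | Neg 'v

primrec lvar :: "'v lit \<Rightarrow> 'v" where
  "lvar (Pos v) = v"
| "lvar (Neg v) = v"

primrec compl :: "'v lit \<Rightarrow> 'v lit" where
  "compl (Pos v) = Neg v"
| "compl (Neg v) = Pos v"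

type_synonym 'v cls = "'v lit set"

definition clause :: "'v cls \<Rightarrow> bool" where
  "clause C \<longleftrightarrow> finite C \<and> (\<forall>x\<in>C. compl x \<notin> C)"

definition clause_set :: "'v cls set \<Rightarrow> bool" where
  "clause_set F \<longleftrightarrow> finite F \<and> (\<forall>C\<in>F. clause C)"

definition cvars :: "'v cls \<Rightarrow> 'v set" where
  "cvars C = lvar ` C"

definition vars :: "'v cls set \<Rightarrow> 'v set" where
  "vars F = (\<Union>C\<in>F. cvars C)"


text \<open>Partial assignments are maps; \<open>dom \<phi>\<close> is the set of assigned variables.\<close>

type_synonym 'v pass = "'v \<rightharpoonup> bool"

primrec lit_val :: "'v pass \<Rightarrow> 'v lit \<Rightarrow> bool option" where
  "lit_val \<phi> (Pos v) = \<phi> v"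
| "lit_val \<phi> (Neg v) = map_option Not (\<phi> v)"

definition app :: "'v pass \<Rightarrow> 'v cls set \<Rightarrow> 'v cls set" where
  "app \<phi> F = {{x \<in> C. lit_val \<phi> x \<noteq> Some False} | C.
      C \<in> F \<and> (\<forall>x\<in>C. lit_val \<phi> x \<noteq> Some True)}"

primrec set_lit :: "'v lit \<Rightarrow> bool \<Rightarrow> 'v pass" where
  "set_lit (Pos v) b = [v \<mapsto> b]"
| "set_lit (Neg v) b = [v \<mapsto> \<not> b]"

definition satisfiable :: "'v cls set \<Rightarrow> bool" where
  "satisfiable F \<longleftrightarrow> (\<exists>\<phi>. app \<phi> F = {})"

definition forced :: "'v cls set \<Rightarrow> 'v lit \<Rightarrow> bool" where
  "forced F x \<longleftrightarrow> \<not> satisfiable (app (set_lit x False) F)"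

text \<open>Unit-clause propagation. The result does not depend on which unit clause is
  propagated first; on finite clause-sets the recursion terminates, since each step
  eliminates a variable.\<close>

partial_function (tailrec) r1 :: "'v cls set \<Rightarrow> 'v cls set" where
  "r1 F = (if {} \<in> F then {{}}
           else if \<exists>x. {x} \<in> F then r1 (app (set_lit (SOME x. {x} \<in> F) True) F)
           else F)"

definition phd_le1 :: "'v set \<Rightarrow> 'v cls set \<Rightarrow> bool" where
  "phd_le1 V F \<longleftrightarrow> (\<forall>\<phi>. dom \<phi> \<subseteq> V \<longrightarrow>
     (if satisfiable (app \<phi> F)
      then \<not> (\<exists>x. lvar x \<in> V \<and> forced (r1 (app \<phi> F)) x)
      else r1 (app \<phi> F) = {{}}))"

definition PC :: "'v cls set set" where
  "PC = {F. clause_set F \<and> phd_le1 (vars F) F}"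


text \<open>XOR-clauses are clauses \<open>C\<close> read as \<open>\<Oplus>\<^sub>x\<^sub>\<in>\<^sub>C x = 0\<close>. Satisfaction is only used
  for \<open>\<phi>\<close> defined on all variables of \<open>F\<close>.\<close>

definition xor_sat :: "'v pass \<Rightarrow> 'v cls set \<Rightarrow> bool" where
  "xor_sat \<phi> F \<longleftrightarrow> (\<forall>C\<in>F. (\<Sum>x\<in>C. of_bool (lit_val \<phi> x = Some True)) = (0::bit))"

text \<open>Adjacency in the incidence graph with parts \<open>vars F\<close> and \<open>F\<close>.\<close>

fun inc_adj :: "'v cls set \<Rightarrow> 'v + 'v cls \<Rightarrow> 'v + 'v cls \<Rightarrow> bool" where
  "inc_adj F (Inl v) (Inr C) \<longleftrightarrow> C \<in> F \<and> v \<in> cvars C"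
| "inc_adj F (Inr C) (Inl v) \<longleftrightarrow> C \<in> F \<and> v \<in> cvars C"
| "inc_adj F _ _ \<longleftrightarrow> False"

text \<open>A cycle of a simple undirected graph, given by its list of vertices in cyclic order.\<close>

definition is_cycle :: "('a \<Rightarrow> 'a \<Rightarrow> bool) \<Rightarrow> 'a list \<Rightarrow> bool" where
  "is_cycle adj p \<longleftrightarrow> length p \<ge> 3 \<and> distinct p \<and>
     (\<forall>i<length p. adj (p ! i) (p ! (Suc i mod length p)))"

definition acyclic_cls :: "'v cls set \<Rightarrow> bool" where
  "acyclic_cls F \<longleftrightarrow> \<not> (\<exists>p. is_cycle (inc_adj F) p)"

definition num_neg :: "'v cls \<Rightarrow> nat" where
  "num_neg C = card {x \<in> C. \<exists>v. x = Neg v}"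

definition X0 :: "'v cls \<Rightarrow> 'v cls set" where
  "X0 C = {D. clause D \<and> cvars D = cvars C \<and> even (num_neg D) \<noteq> even (num_neg C)}"

text \<open>The natural splitting of the XOR-clause whose literals, in the chosen order, are
  \<open>x\<^sub>1, \<dots>, x\<^sub>n\<close>; as lists are indexed from \<open>0\<close>, \<open>x\<^sub>i\<close> is \<open>xs ! (i - 1)\<close>. The new variables
  are \<open>y 2, \<dots>, y (n - 1)\<close>.\<close>

definition nat_split :: "(nat \<Rightarrow> 'v) \<Rightarrow> 'v lit list \<Rightarrow> 'v cls set" where
  "nat_split y xs = (let n = length xs in
     if n \<le> 2 then {set xs}
     else {{xs ! 0, xs ! 1, Pos (y 2)}}
        \<union> {{Pos (y (i - 1)), xs ! (i - 1), Pos (y i)} | i. 3 \<le> i \<and> i \<le> n - 1}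
        \<union> {{Pos (y (n - 1)), xs ! (n - 1)}})"

definition X1_clause :: "(nat \<Rightarrow> 'v) \<Rightarrow> 'v lit list \<Rightarrow> 'v cls set" where
  "X1_clause y xs = (\<Union>D\<in>nat_split y xs. X0 D)"

text \<open>\<open>X\<^sub>1(F)\<close> depends on an ordering \<open>enum C\<close> of the literals of each \<open>C \<in> F\<close>
  and on the new variables \<open>y C j\<close>.\<close>

definition X1 :: "('v cls \<Rightarrow> 'v lit list) \<Rightarrow> ('v cls \<Rightarrow> nat \<Rightarrow> 'v) \<Rightarrow> 'v cls set \<Rightarrow> 'v cls set" where
  "X1 enum y F = (\<Union>C\<in>F. X1_clause (y C) (enum C))"

definition literal_order :: "'v cls set \<Rightarrow> ('v cls \<Rightarrow> 'v lit list) \<Rightarrow> bool" where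
  "literal_order F enum \<longleftrightarrow> (\<forall>C\<in>F. distinct (enum C) \<and> set (enum C) = C)"

definition new_vars :: "'v cls set \<Rightarrow> ('v cls \<Rightarrow> nat \<Rightarrow> 'v) \<Rightarrow> bool" where
  "new_vars F y \<longleftrightarrow>
     inj_on (\<lambda>(C, j). y C j) (SIGMA C:F. {2..card C - 1}) \<and>
     (\<forall>C\<in>F. \<forall>j\<in>{2..card C - 1}. y C j \<notin> vars F)"

lemma ex_new_vars:
  assumes "infinite (UNIV :: 'v set)" and "clause_set (F :: 'v cls set)"
  shows "\<exists>enum y. literal_order F enum \<and> new_vars F y"
proof -
  let ?S = "SIGMA C:F. {2..card C - 1}"
  have fin: "finite F" "\<And>C. C \<in> F \<Longrightarrow> finite C"
    using assms(2) by (auto simp: clause_set_def clause_def)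
  have "\<forall>C\<in>F. \<exists>xs. distinct xs \<and> set xs = C"
    using fin(2) finite_distinct_list by blast
  then have "\<exists>enum. literal_order F enum"
    unfolding literal_order_def by metis
  moreover have "\<exists>y. new_vars F y"
  proof -
    have "finite (vars F)" using fin by (auto simp: vars_def cvars_def)
    then have "infinite (- vars F)" using assms(1) by (simp add: Compl_eq_Diff_UNIV)
    then obtain B where B: "finite B" "card B = card ?S" "B \<subseteq> - vars F"
      using infinite_arbitrarily_large by blast
    have "finite ?S" using fin by auto
    then obtain f where f: "bij_betw f ?S B"
      using B finite_same_card_bij by metis
    have "new_vars F (\<lambda>C j. f (C, j))"
      unfolding new_vars_def
    proof (intro conjI ballI)
      show "inj_on (\<lambda>(C, j). f (C, j)) ?S" using f by (simp add: bij_betw_def)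
    next
      fix C j assume "C \<in> F" "j \<in> {2..card C - 1}"
      then have "(C, j) \<in> ?S" by blast
      then have "f (C, j) \<in> B" using f bij_betwE by blast
      then show "f (C, j) \<notin> vars F" using B by blast
    qed
    then show ?thesis by blast
  qed
  ultimately show ?thesis by blast
qed


definition cnf_representation :: "'v cls set \<Rightarrow> 'v cls set \<Rightarrow> bool" where
  "cnf_representation F F' \<longleftrightarrow> clause_set F' \<and> vars F \<subseteq> vars F' \<and>
     (\<forall>\<phi>. dom \<phi> = vars F \<longrightarrow> (satisfiable (app \<phi> F') \<longleftrightarrow> xor_sat \<phi> F))"

definition forcing_representation :: "'v cls set \<Rightarrow> 'v cls set \<Rightarrow> bool" where
  "forcing_representation F F' \<longleftrightarrow> cnf_representation F F' \<and> phd_le1 (vars F) F' \<and>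
     (\<forall>\<phi>. dom \<phi> = vars F \<and> satisfiable (app \<phi> F') \<longrightarrow> r1 (app \<phi> F') = {})"

definition absolute_forcing_representation :: "'v cls set \<Rightarrow> 'v cls set \<Rightarrow> bool" where
  "absolute_forcing_representation F F' \<longleftrightarrow> forcing_representation F F' \<and> F' \<in> PC"

end

theory Submission imports Defs begin

text \<open>
  Write \<open>X\<^sub>1(F)\<close> as the union of \<open>X\<^sub>0(D)\<close> over the pieces \<open>D\<close> of the splitting. The incidence
  graph of the pieces is again a forest, because the pieces of one clause form a path. Once
  unit propagation has stopped without conflict, no piece has exactly one unassigned variable.
  In such a forest, one unassigned variable can be given any value and the system still be
  solved: some other unassigned variable lies in a single piece, so this piece can be
  dropped and repaired at the end. Hence no literal is forced, over any set of variables.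
  When all variables of \<open>F\<close> are assigned, propagation runs along each path.
\<close>

subsection \<open>Total assignments\<close>

text \<open>Forests enter only through \<open>leafy\<close>: every nonempty set of incidences has an
  edge with an end of degree one. Unlike the absence of a listed cycle, this passes directly to
  subsystems and to what is left after deleting assigned variables. After propagation an end of
  degree one cannot be a piece, because \<open>X0\<close> of a piece with a single unassigned
  variable would leave a unit clause; so it is a variable, which is what the elimination needs. The
  delicate case is that this variable is the very one whose value is prescribed. Absence of forced
  literals also settles the unsatisfiable restrictions: a literal that is not forced comes with a
  model, so a restriction without model must have ended in a conflict. The leaf property moves from
  \<open>F\<close> to the splitting by contracting each path of pieces to its clause.\<close>

primrec lit_true :: "('v \<Rightarrow> bool) \<Rightarrow> 'v lit \<Rightarrow> bool" where
  "lit_true f (Pos v) = f v"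
| "lit_true f (Neg v) = (\<not> f v)"

definition models :: "('v \<Rightarrow> bool) \<Rightarrow> 'v cls set \<Rightarrow> bool" where
  "models f F \<longleftrightarrow> (\<forall>C\<in>F. \<exists>x\<in>C. lit_true f x)"

definition extends :: "('v \<Rightarrow> bool) \<Rightarrow> 'v pass \<Rightarrow> bool" where
  "extends f \<phi> \<longleftrightarrow> (\<forall>v b. \<phi> v = Some b \<longrightarrow> f v = b)"

lemma extends_map_le: "extends f \<psi> \<Longrightarrow> \<phi> \<subseteq>\<^sub>m \<psi> \<Longrightarrow> extends f \<phi>"
  unfolding extends_def map_le_def by (metis domI)

text \<open>Both a propagation step and the test for a forced literal end up as
  \<open>set_lit x b ++ \<psi>\<close>. The right operand wins, so setting \<open>x\<close> matters
  only if its variable is still free.\<close>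

lemma extends_set_lit_map_add:
  "extends f (set_lit x b ++ \<psi>) \<longleftrightarrow> extends f \<psi> \<and> (lvar x \<notin> dom \<psi> \<longrightarrow> lit_true f x = b)"
  by (cases x) (auto simp: extends_def map_add_def split: option.splits if_splits)

lemma lit_val_None_iff: "lit_val \<phi> x = None \<longleftrightarrow> lvar x \<notin> dom \<phi>"
  by (cases x) auto

lemma lit_val_extends:
  assumes "extends f \<phi>" "lvar x \<in> dom \<phi>"
  shows "lit_val \<phi> x = Some (lit_true f x)"
  using assms by (cases x) (auto simp: extends_def)

lemma lit_val_map_add:
  "lit_val (\<theta> ++ \<phi>) x = (case lit_val \<phi> x of None \<Rightarrow> lit_val \<theta> x | Some b \<Rightarrow> Some b)"
  by (cases x) (auto simp: map_add_def split: option.splits)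

text \<open>Literals assigned by \<open>\<phi>\<close> are gone when \<open>\<theta>\<close> is
  applied, so \<open>\<phi>\<close> has priority and stands on the right. Everything can thus be
  read as one assignment applied to the original clause-set.\<close>

lemma app_app: "app \<theta> (app \<phi> F) = app (\<theta> ++ \<phi>) F"
proof -
  have *: "{x \<in> {x \<in> C. lit_val \<phi> x \<noteq> Some False}. lit_val \<theta> x \<noteq> Some False}
      = {x \<in> C. lit_val (\<theta> ++ \<phi>) x \<noteq> Some False}"
    if "\<forall>x\<in>C. lit_val \<phi> x \<noteq> Some True" for C
    using that by (auto simp: lit_val_map_add split: option.splits)
  have **: "(\<forall>x\<in>C. lit_val \<phi> x \<noteq> Some True) \<and>
      (\<forall>x\<in>{x \<in> C. lit_val \<phi> x \<noteq> Some False}. lit_val \<theta> x \<noteq> Some True)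
      \<longleftrightarrow> (\<forall>x\<in>C. lit_val (\<theta> ++ \<phi>) x \<noteq> Some True)" for C
  proof -
    have "lit_val (\<theta> ++ \<phi>) x \<noteq> Some True \<longleftrightarrow> lit_val \<phi> x \<noteq> Some True \<and>
        (lit_val \<phi> x \<noteq> Some False \<longrightarrow> lit_val \<theta> x \<noteq> Some True)" for x
      by (cases "lit_val \<phi> x") (auto simp: lit_val_map_add)
    then show ?thesis by blast
  qed
  show ?thesis
  proof (intro equalityI subsetI)
    fix D assume "D \<in> app \<theta> (app \<phi> F)"
    then obtain C where "C \<in> F" and C: "\<forall>x\<in>C. lit_val \<phi> x \<noteq> Some True"
      "\<forall>x\<in>{x \<in> C. lit_val \<phi> x \<noteq> Some False}. lit_val \<theta> x \<noteq> Some True"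
      and "D = {x \<in> {x \<in> C. lit_val \<phi> x \<noteq> Some False}. lit_val \<theta> x \<noteq> Some False}"
      unfolding app_def by blast
    then show "D \<in> app (\<theta> ++ \<phi>) F"
      using *[OF C(1)] **[of C] unfolding app_def by blast
  next
    fix D assume "D \<in> app (\<theta> ++ \<phi>) F"
    then obtain C where "C \<in> F" and C: "\<forall>x\<in>C. lit_val (\<theta> ++ \<phi>) x \<noteq> Some True"
      and D: "D = {x \<in> C. lit_val (\<theta> ++ \<phi>) x \<noteq> Some False}"
      unfolding app_def by blast
    have C': "\<forall>x\<in>C. lit_val \<phi> x \<noteq> Some True"
      "\<forall>x\<in>{x \<in> C. lit_val \<phi> x \<noteq> Some False}. lit_val \<theta> x \<noteq> Some True"
      using C **[of C] by blast+
    then have "{x \<in> C. lit_val \<phi> x \<noteq> Some False} \<in> app \<phi> F"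
      using \<open>C \<in> F\<close> unfolding app_def by blast
    then show "D \<in> app \<theta> (app \<phi> F)"
      using D *[OF C'(1)] C'(2) unfolding app_def[of \<theta>] by blast
  qed
qed

lemma satisfiable_iff_models: "satisfiable F \<longleftrightarrow> (\<exists>f. models f F)"
proof
  assume "satisfiable F"
  then obtain \<phi> where \<phi>: "app \<phi> F = {}" by (auto simp: satisfiable_def)
  \<comment> \<open>The default False is harmless: each clause already has a literal that
    \<open>\<phi>\<close> makes true.\<close>
  have "models (\<lambda>v. \<phi> v = Some True) F"
    unfolding models_def
  proof
    fix C assume "C \<in> F"
    with \<phi> obtain x where "x \<in> C" "lit_val \<phi> x = Some True"
      unfolding app_def by blast
    moreover from this have "lit_true (\<lambda>v. \<phi> v = Some True) x" by (cases x) auto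
    ultimately show "\<exists>x\<in>C. lit_true (\<lambda>v. \<phi> v = Some True) x" by blast
  qed
  then show "\<exists>f. models f F" by blast
next
  assume "\<exists>f. models f F"
  then obtain f where f: "models f F" by blast
  have "lit_val (Some \<circ> f) x = Some (lit_true f x)" for x by (cases x) auto
  then have "app (Some \<circ> f) F = {}" using f by (auto simp: app_def models_def)
  then show "satisfiable F" by (auto simp: satisfiable_def)
qed

lemma models_app_iff:
  assumes "extends f \<phi>"
  shows "models f (app \<phi> F) \<longleftrightarrow> models f F"
proof
  assume f: "models f (app \<phi> F)"
  show "models f F"
    unfolding models_def
  proof
    fix C assume "C \<in> F"
    show "\<exists>x\<in>C. lit_true f x"
    proof (cases "\<exists>x\<in>C. lit_val \<phi> x = Some True")
      case True
      then show ?thesis using lit_val_extends[OF assms] lit_val_None_iff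
        by (metis option.distinct(1) option.inject)
    next
      case False
      then have "{x \<in> C. lit_val \<phi> x \<noteq> Some False} \<in> app \<phi> F"
        using \<open>C \<in> F\<close> by (auto simp: app_def)
      then show ?thesis using f by (auto simp: models_def)
    qed
  qed
next
  assume f: "models f F"
  show "models f (app \<phi> F)"
    unfolding models_def
  proof
    fix D assume "D \<in> app \<phi> F"
    then obtain C where C: "C \<in> F" "D = {x \<in> C. lit_val \<phi> x \<noteq> Some False}"
      by (auto simp: app_def)
    with f obtain x where "x \<in> C" "lit_true f x" by (auto simp: models_def)
    moreover have "lit_val \<phi> x \<noteq> Some False"
      using lit_val_extends[OF assms] lit_val_None_iff \<open>lit_true f x\<close>
      by (metis option.distinct(1) option.inject)
    ultimately show "\<exists>x\<in>D. lit_true f x" using C by blast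
  qed
qed

lemma satisfiable_app_iff:
  "satisfiable (app \<phi> F) \<longleftrightarrow> (\<exists>f. extends f \<phi> \<and> models f F)"
proof
  assume "satisfiable (app \<phi> F)"
  then obtain g where g: "models g (app \<phi> F)" by (auto simp: satisfiable_iff_models)
  \<comment> \<open>The model \<open>g\<close> may disagree with \<open>\<phi>\<close>, so it is
    overwritten there; literals surviving in \<open>app \<phi> F\<close> are unassigned and keep
    their value.\<close>
  define f where "f v = (case \<phi> v of None \<Rightarrow> g v | Some b \<Rightarrow> b)" for v
  have e: "extends f \<phi>" by (auto simp: extends_def f_def)
  have "models f (app \<phi> F)"
    unfolding models_def
  proof
    fix D assume D: "D \<in> app \<phi> F"
    with g obtain x where x: "x \<in> D" "lit_true g x" by (auto simp: models_def)
    obtain C where "\<forall>x\<in>C. lit_val \<phi> x \<noteq> Some True" "D = {x \<in> C. lit_val \<phi> x \<noteq> Some False}"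
      using D unfolding app_def by blast
    then have "lit_val \<phi> x = None" using x by (cases "lit_val \<phi> x") auto
    then have "lit_true f x = lit_true g x"
      by (cases x) (auto simp: f_def)
    then show "\<exists>x\<in>D. lit_true f x" using x by blast
  qed
  then show "\<exists>f. extends f \<phi> \<and> models f F" using e models_app_iff by blast
next
  assume "\<exists>f. extends f \<phi> \<and> models f F"
  then show "satisfiable (app \<phi> F)" using models_app_iff satisfiable_iff_models by blast
qed


subsection \<open>Unit-clause propagation\<close>

text \<open>Propagation only enlarges the assignment, and a unit literal holds in every model, so
  unsatisfiability found at a conflict goes back to the start. Counting the unassigned variables
  supplies the termination that \<open>partial_function\<close> does not provide.\<close>

lemma r1_app_cases:
  assumes "clause_set F"
  shows "(r1 (app \<phi> F) = {{}} \<and> \<not> satisfiable (app \<phi> F)) \<or>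
    (\<exists>\<psi>. \<phi> \<subseteq>\<^sub>m \<psi> \<and> r1 (app \<phi> F) = app \<psi> F \<and> {} \<notin> app \<psi> F \<and> (\<forall>x. {x} \<notin> app \<psi> F))"
proof (induction "card (vars F - dom \<phi>)" arbitrary: \<phi> rule: less_induct)
  case less
  have fin: "finite (vars F)"
    using assms by (auto simp: clause_set_def clause_def vars_def cvars_def)
  show ?case
  proof (cases "{} \<in> app \<phi> F")
    case True
    then have "r1 (app \<phi> F) = {{}}" by (subst r1.simps) simp
    moreover have "\<not> satisfiable (app \<phi> F)"
      using True by (auto simp: satisfiable_iff_models models_def)
    ultimately show ?thesis by blast
  next
    case noempty: False
    show ?thesis
    proof (cases "\<exists>x. {x} \<in> app \<phi> F")
      case False
      then have "r1 (app \<phi> F) = app \<phi> F" using noempty by (subst r1.simps) simp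
      then show ?thesis using False noempty by (intro disjI2 exI[of _ \<phi>]) auto
    next
      case True
      define x where "x = (SOME x. {x} \<in> app \<phi> F)"
      have x: "{x} \<in> app \<phi> F" unfolding x_def using True by (rule someI_ex)
      define \<theta> where "\<theta> = set_lit x True ++ \<phi>"
      have r: "r1 (app \<phi> F) = r1 (app \<theta> F)"
        using noempty True by (subst r1.simps) (simp add: x_def[symmetric] \<theta>_def app_app)
      obtain C where C: "C \<in> F" "\<forall>z\<in>C. lit_val \<phi> z \<noteq> Some True"
        "{x} = {z \<in> C. lit_val \<phi> z \<noteq> Some False}"
        using x unfolding app_def by blast
      \<comment> \<open>A true literal would have removed \<open>C\<close> and a false one would
        have been deleted, so \<open>x\<close> is unassigned and the measure drops.\<close>
      then have "x \<in> C" "lit_val \<phi> x \<noteq> Some False" by blast+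
      then have "lit_val \<phi> x = None" using C(2) by (cases "lit_val \<phi> x") auto
      then have xd: "lvar x \<notin> dom \<phi>" by (simp add: lit_val_None_iff)
      have xv: "lvar x \<in> vars F" using \<open>x \<in> C\<close> C(1) by (auto simp: vars_def cvars_def)
      have dom: "dom \<theta> = insert (lvar x) (dom \<phi>)"
        unfolding \<theta>_def by (cases x) auto
      have le: "\<phi> \<subseteq>\<^sub>m \<theta>" by (auto simp: \<theta>_def map_le_def map_add_def split: option.splits)
      have lt: "card (vars F - dom \<theta>) < card (vars F - dom \<phi>)"
        using fin xd xv by (intro psubset_card_mono) (auto simp: dom)
      have sat: "satisfiable (app \<theta> F)" if s: "satisfiable (app \<phi> F)"
      proof -
        obtain f where f: "extends f \<phi>" "models f F"
          using satisfiable_app_iff[THEN iffD1, OF s] by blast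
        then have "models f (app \<phi> F)" by (simp add: models_app_iff)
        then have "lit_true f x" using x by (auto simp: models_def)
        then have "extends f \<theta>"
          using f(1) by (simp add: \<theta>_def extends_set_lit_map_add)
        then show ?thesis using f satisfiable_app_iff by blast
      qed
      from less[OF lt] show ?thesis
      proof
        assume "r1 (app \<theta> F) = {{}} \<and> \<not> satisfiable (app \<theta> F)"
        then show ?thesis using r sat by auto
      next
        assume "\<exists>\<psi>. \<theta> \<subseteq>\<^sub>m \<psi> \<and> r1 (app \<theta> F) = app \<psi> F \<and> {} \<notin> app \<psi> F \<and> (\<forall>x. {x} \<notin> app \<psi> F)"
        then show ?thesis unfolding r using map_le_trans[OF le] by blast
      qed
    qed
  qed
qed


subsection \<open>XOR-clauses\<close>

definition xsum :: "('v \<Rightarrow> bool) \<Rightarrow> 'v cls \<Rightarrow> bit" where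
  "xsum f C = (\<Sum>x\<in>C. of_bool (lit_true f x))"

lemma lit_true_cong: "f (lvar x) = g (lvar x) \<Longrightarrow> lit_true f x = lit_true g x"
  by (cases x) auto

lemma xsum_cong:
  assumes "\<And>v. v \<in> cvars C \<Longrightarrow> f v = g v"
  shows "xsum f C = xsum g C"
  unfolding xsum_def using assms
  by (intro sum.cong refl arg_cong[where f = of_bool] lit_true_cong) (auto simp: cvars_def)

lemma clause_lit_unique:
  assumes "clause C" "x \<in> C" "z \<in> C" "lvar x = lvar z"
  shows "x = z"
  using assms by (cases x; cases z) (auto simp: clause_def)

text \<open>Without complementary pairs, exactly one literal of \<open>C\<close> has the variable
  \<open>w\<close>.\<close>

lemma xsum_flip:
  assumes "clause C" "w \<in> cvars C"
  shows "xsum (f(w := \<not> f w)) C = xsum f C + 1"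
proof -
  obtain x where x: "x \<in> C" "lvar x = w" using assms(2) by (auto simp: cvars_def)
  have fin: "finite C" using assms(1) by (simp add: clause_def)
  have "xsum (f(w := \<not> f w)) (C - {x}) = xsum f (C - {x})"
    using x clause_lit_unique[OF assms(1)] by (intro xsum_cong) (auto simp: cvars_def)
  moreover have "of_bool (lit_true (f(w := \<not> f w)) x) = (of_bool (lit_true f x) :: bit) + 1"
    using x by (cases x) auto
  ultimately show ?thesis
    unfolding xsum_def by (simp add: sum.remove[OF fin x(1)] add_ac)
qed

lemma bit_neq_0: "b \<noteq> 0 \<longleftrightarrow> b = (1 :: bit)"
  by (cases b) auto

text \<open>The clause over \<open>V\<close> that excludes precisely the assignments agreeing with
  \<open>f\<close> on \<open>V\<close>; \<open>X0\<close> excludes the wrong assignments of an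
  XOR-clause one by one in this way.\<close>

definition falsified_clause :: "('v \<Rightarrow> bool) \<Rightarrow> 'v set \<Rightarrow> 'v cls" where
  "falsified_clause f V = (\<lambda>v. if f v then Neg v else Pos v) ` V"

lemma cvars_falsified_clause: "cvars (falsified_clause f V) = V"
proof -
  have "lvar (if f v then Neg v else Pos v) = v" for v by simp
  then show ?thesis
    by (simp add: cvars_def falsified_clause_def image_image del: if_image_distrib)
qed

lemma falsified_clause_unique:
  assumes "\<forall>x\<in>C. \<not> lit_true f x"
  shows "C = falsified_clause f (cvars C)"
proof -
  have *: "x = (if f (lvar x) then Neg (lvar x) else Pos (lvar x))" if "x \<in> C" for x
    using assms that by (cases x) auto
  show ?thesis
    unfolding falsified_clause_def cvars_def image_image using * by force
qed

text \<open>A literal is true iff exactly one of these holds: its variable is true under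
  \<open>f\<close>, or it is complemented. The falsified clause complements exactly the variables
  that are true.\<close>

lemma xsum_eq_num_neg:
  assumes "clause C"
  shows "xsum f C = of_nat (num_neg (falsified_clause f (cvars C)) + num_neg C)"
proof -
  have fin: "finite C" using assms by (simp add: clause_def)
  have inj: "inj_on lvar C" using clause_lit_unique[OF assms] by (auto simp: inj_on_def)
  have "{x \<in> falsified_clause f (cvars C). \<exists>v. x = Neg v} = (Neg \<circ> lvar) ` {x \<in> C. f (lvar x)}"
    by (auto simp: falsified_clause_def cvars_def image_iff)
  moreover have "inj_on (Neg \<circ> lvar) {x \<in> C. f (lvar x)}"
    using inj by (auto simp: inj_on_def)
  ultimately have "num_neg (falsified_clause f (cvars C)) = card {x \<in> C. f (lvar x)}"
    by (simp only: num_neg_def card_image)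
  then have "of_nat (num_neg (falsified_clause f (cvars C)) + num_neg C)
      = (\<Sum>x\<in>C. of_bool (f (lvar x)) + of_bool (\<exists>v. x = Neg v) :: bit)"
  proof -
    have card: "of_nat (card {x \<in> C. P x}) = (\<Sum>x\<in>C. of_bool (P x) :: bit)" for P
      using fin by (simp add: Int_def)
    assume "num_neg (falsified_clause f (cvars C)) = card {x \<in> C. f (lvar x)}"
    then show ?thesis by (simp only: num_neg_def[of C] of_nat_add card sum.distrib)
  qed
  also have "\<dots> = xsum f C"
    unfolding xsum_def
  proof (intro sum.cong refl)
    fix x :: "'a lit"
    show "of_bool (f (lvar x)) + of_bool (\<exists>v. x = Neg v) = (of_bool (lit_true f x) :: bit)"
      by (cases x) auto
  qed
  finally show ?thesis by simp
qed

lemma falsified_clause_in_X0_iff: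
  assumes "clause C"
  shows "falsified_clause f (cvars C) \<in> X0 C \<longleftrightarrow> xsum f C = 1"
proof -
  have "finite (cvars C)" using assms by (simp add: clause_def cvars_def)
  then have "clause (falsified_clause f (cvars C))"
    by (auto simp: clause_def falsified_clause_def)
  moreover have "of_nat k = (1 :: bit) \<longleftrightarrow> odd k" for k :: nat
    by (induction k) (auto simp: bit_neq_0)
  ultimately show ?thesis
    by (auto simp: X0_def cvars_falsified_clause xsum_eq_num_neg[OF assms])
qed

lemma models_X0_iff:
  assumes "clause C"
  shows "models f (X0 C) \<longleftrightarrow> xsum f C = 0"
proof
  have "\<not> lit_true f x" if "x \<in> falsified_clause f (cvars C)" for x
    using that by (auto simp: falsified_clause_def)
  moreover assume "models f (X0 C)"
  ultimately have "falsified_clause f (cvars C) \<notin> X0 C" by (auto simp: models_def)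
  then show "xsum f C = 0"
    using falsified_clause_in_X0_iff[OF assms] bit_neq_0 by blast
next
  assume 0: "xsum f C = 0"
  show "models f (X0 C)"
    unfolding models_def
  proof (rule ballI, rule ccontr)
    fix D assume D: "D \<in> X0 C" "\<not> (\<exists>x\<in>D. lit_true f x)"
    then have "D = falsified_clause f (cvars C)"
      using falsified_clause_unique[of D f] by (auto simp: X0_def)
    then show False using D(1) 0 falsified_clause_in_X0_iff[OF assms, of f] by auto
  qed
qed

text \<open>No literal of the falsified clause is true under \<open>\<psi>\<close>, and those on
  assigned variables are deleted. As \<open>f\<close> is free outside \<open>dom \<psi>\<close>, it
  can be chosen to expose short clauses.\<close>

lemma falsified_clause_in_app:
  assumes "clause C" "extends f \<psi>" "xsum f C = 1"
  shows "falsified_clause f (cvars C - dom \<psi>) \<in> app \<psi> (X0 C)"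
proof -
  let ?D = "falsified_clause f (cvars C)"
  have D: "?D \<in> X0 C" using assms falsified_clause_in_X0_iff by blast
  have false: "\<not> lit_true f x" if "x \<in> ?D" for x
    using that by (auto simp: falsified_clause_def)
  have val: "lit_val \<psi> x = (if lvar x \<in> dom \<psi> then Some False else None)" if "x \<in> ?D" for x
    using lit_val_extends[OF assms(2)] false[OF that] lit_val_None_iff[of \<psi> x] by auto
  have "{x \<in> ?D. lit_val \<psi> x \<noteq> Some False} = {x \<in> ?D. lvar x \<notin> dom \<psi>}"
    by (intro Collect_cong conj_cong refl) (simp add: val)
  also have "\<dots> = falsified_clause f (cvars C - dom \<psi>)"
    by (auto simp: falsified_clause_def)
  finally show ?thesis
    using D val unfolding app_def by (intro CollectI exI[of _ ?D]) auto
qed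

lemma propagated_xor_clause:
  assumes "clause C" "extends f \<psi>"
    and "{} \<notin> app \<psi> (X0 C)" "\<And>x. {x} \<notin> app \<psi> (X0 C)"
  shows "card (cvars C - dom \<psi>) \<noteq> 1" and "cvars C \<subseteq> dom \<psi> \<Longrightarrow> xsum f C = 0"
proof -
  show "xsum f C = 0" if "cvars C \<subseteq> dom \<psi>"
  proof (rule ccontr)
    assume "xsum f C \<noteq> 0"
    then have "falsified_clause f (cvars C - dom \<psi>) \<in> app \<psi> (X0 C)"
      using falsified_clause_in_app assms(1,2) bit_neq_0 by blast
    moreover have "cvars C - dom \<psi> = {}" using that by blast
    ultimately show False using assms(3) by (simp add: falsified_clause_def)
  qed
  show "card (cvars C - dom \<psi>) \<noteq> 1"
  proof
    assume "card (cvars C - dom \<psi>) = 1"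
    then obtain w where w: "cvars C - dom \<psi> = {w}" by (auto simp: card_1_singleton_iff)
    \<comment> \<open>With \<open>w\<close> free, the sum can be made 1 by flipping \<open>w\<close>
      if necessary; the falsified clause then shrinks to a unit clause over
      \<open>w\<close>.\<close>
    define g where "g = (if xsum f C = 1 then f else f(w := \<not> f w))"
    have "xsum g C = 1"
    proof -
      have "w \<in> cvars C" using w by blast
      then show ?thesis
        using xsum_flip[OF assms(1), of w f] bit_neq_0 by (auto simp: g_def)
    qed
    moreover have "extends g \<psi>" using assms(2) w by (auto simp: extends_def g_def)
    ultimately have "falsified_clause g {w} \<in> app \<psi> (X0 C)"
      using falsified_clause_in_app[OF assms(1)] w by metis
    then show False using assms(4) by (simp only: falsified_clause_def image_insert image_empty)
  qed
qed

lemma clause_set_X0: "clause C \<Longrightarrow> clause_set (X0 C)"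
proof -
  assume "clause C"
  then have "finite (Pow (Pos ` cvars C \<union> Neg ` cvars C))" by (simp add: clause_def cvars_def)
  moreover have "x \<in> Pos ` V \<union> Neg ` V" if "lvar x \<in> V" for x :: "'a lit" and V
    using that by (cases x) auto
  then have "X0 C \<subseteq> Pow (Pos ` cvars C \<union> Neg ` cvars C)"
    unfolding X0_def cvars_def by blast
  ultimately show ?thesis
    by (auto simp: clause_set_def X0_def dest: finite_subset)
qed

lemma vars_X0:
  assumes "clause C"
  shows "vars (X0 C) = cvars C"
proof
  show "vars (X0 C) \<subseteq> cvars C" by (auto simp: vars_def X0_def)
  show "cvars C \<subseteq> vars (X0 C)"
  proof
    fix v assume v: "v \<in> cvars C"
    \<comment> \<open>One of the constant assignment and its flip at \<open>v\<close> has sum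
      1.\<close>
    obtain f where "xsum f C = 1"
      using xsum_flip[OF assms v, of "\<lambda>_. True"] bit_neq_0 by (metis add_0)
    then have "falsified_clause f (cvars C) \<in> X0 C"
      using falsified_clause_in_X0_iff[OF assms] by blast
    then show "v \<in> vars (X0 C)"
      using v cvars_falsified_clause[of f "cvars C"] unfolding vars_def by blast
  qed
qed


subsection \<open>Acyclicity\<close>

definition has_leaf :: "('a \<times> 'b) set \<Rightarrow> bool" where
  "has_leaf E \<longleftrightarrow> (\<exists>(v, C)\<in>E. (\<forall>C'. (v, C') \<in> E \<longrightarrow> C' = C) \<or> (\<forall>v'. (v', C) \<in> E \<longrightarrow> v' = v))"

definition incidences :: "'v cls set \<Rightarrow> ('v \<times> 'v cls) set" where
  "incidences H = {(v, C). C \<in> H \<and> v \<in> cvars C}"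

text \<open>For finite \<open>H\<close> with finite clauses this says that the incidence graph is a
  forest. It quantifies over edge sets so that the edges at assigned variables can simply be
  subtracted.\<close>

definition leafy :: "'v cls set \<Rightarrow> bool" where
  "leafy H \<longleftrightarrow> (\<forall>E \<subseteq> incidences H. E \<noteq> {} \<longrightarrow> has_leaf E)"

lemma leafy_subset: "leafy H \<Longrightarrow> H' \<subseteq> H \<Longrightarrow> leafy H'"
proof -
  assume "leafy H" "H' \<subseteq> H"
  moreover from this have "incidences H' \<subseteq> incidences H" by (auto simp: incidences_def)
  ultimately show ?thesis unfolding leafy_def by (meson subset_trans)
qed

text \<open>The first vertex of a longest path has a second neighbour. By maximality that neighbour
  lies on the path, and the edge to it closes a cycle.\<close>

lemma ex_cycle_if_no_leaf:
  fixes adj :: "'a \<Rightarrow> 'a \<Rightarrow> bool"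
  assumes "finite S" "\<And>x z. adj x z \<Longrightarrow> x \<in> S \<and> z \<in> S"
    and sym: "\<And>x z. adj x z \<Longrightarrow> adj z x" and irrefl: "\<And>x. \<not> adj x x"
    and "adj s t"
    and deg: "\<And>x z. adj x z \<Longrightarrow> \<exists>z'. z' \<noteq> z \<and> adj x z'"
  shows "\<exists>p. is_cycle adj p"
proof -
  define path where "path p \<longleftrightarrow> distinct p \<and> set p \<subseteq> S \<and> successively adj p" for p
  have "path [s, t]" using assms by (auto simp: path_def)
  moreover have "length p < Suc (card S)" if "path p" for p
    using that assms(1) by (metis path_def distinct_card card_mono le_imp_less_Suc)
  ultimately obtain p where p: "path p" "2 \<le> length p"
    and max: "\<And>q. path q \<and> 2 \<le> length q \<Longrightarrow> length q \<le> length p"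
    using ex_has_greatest_nat[of "\<lambda>p. path p \<and> 2 \<le> length p" "[s, t]" length "Suc (card S)"]
    by (metis One_nat_def Suc_1 length_Cons list.size(3) order_refl)
  obtain x z r where r: "p = x # z # r"
    using p(2) by (cases p rule: remdups_adj.cases) auto
  then have "adj x z" using p by (simp add: path_def)
  then obtain u where u: "u \<noteq> z" "adj x u" using deg by blast
  have "u \<in> set p"
  proof (rule ccontr)
    assume "u \<notin> set p"
    then have "path (u # p)"
      using p u sym assms(2) r by (auto simp: path_def)
    then show False using max[of "u # p"] p(2) by simp
  qed
  then obtain k where k: "k < length p" "p ! k = u" by (auto simp: in_set_conv_nth)
  \<comment> \<open>Position 0 would be a loop and position 1 is \<open>z\<close>, so the cycle has
    at least three vertices.\<close>
  have k2: "k \<ge> 2"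
    using k u irrefl r by (cases k; cases "k - 1") auto
  let ?q = "take (Suc k) p"
  have len: "length ?q = Suc k" using k by simp
  have "adj (?q ! i) (?q ! (Suc i mod length ?q))" if "i < length ?q" for i
  proof (cases "i = k")
    case True
    then have "?q ! i = u" using k by simp
    moreover have "?q ! (Suc i mod length ?q) = x" using True len r by simp
    ultimately show ?thesis using u(2) sym by simp
  next
    case False
    then have "Suc i < length ?q" using that len by simp
    then show ?thesis
      using p(1) k by (simp add: path_def successively_conv_nth)
  qed
  moreover have "distinct ?q" using p(1) by (simp add: path_def)
  ultimately have "is_cycle adj ?q" using k2 len by (simp add: is_cycle_def)
  then show ?thesis ..
qed

lemma acyclic_imp_leafy:
  assumes "clause_set F" "acyclic_cls F"
  shows "leafy F"
  unfolding leafy_def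
proof (intro allI impI)
  fix E assume E: "E \<subseteq> incidences F" "E \<noteq> {}"
  define adj where "adj a b \<longleftrightarrow> (\<exists>v C. (v, C) \<in> E \<and> (a = Inl v \<and> b = Inr C \<or> a = Inr C \<and> b = Inl v))"
    for a b :: "'a + 'a cls"
  show "has_leaf E"
  proof (rule ccontr)
    assume no: "\<not> has_leaf E"
    obtain v C where vC: "(v, C) \<in> E" using E(2) by auto
    have "\<exists>p. is_cycle adj p"
    proof (rule ex_cycle_if_no_leaf)
      show "finite (Inl ` vars F \<union> Inr ` F)"
        using assms(1) by (auto simp: clause_set_def clause_def vars_def cvars_def)
      show "a \<in> Inl ` vars F \<union> Inr ` F \<and> b \<in> Inl ` vars F \<union> Inr ` F" if adj: "adj a b" for a b
      proof -
        obtain v C where e: "(v, C) \<in> E" "a = Inl v \<and> b = Inr C \<or> a = Inr C \<and> b = Inl v"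
          using adj unfolding adj_def by blast
        then have "v \<in> vars F" "C \<in> F" using E(1) by (auto simp: incidences_def vars_def)
        then show ?thesis using e by blast
      qed
      show "adj b a" if "adj a b" for a b using that by (auto simp: adj_def)
      show "\<not> adj a a" for a by (auto simp: adj_def)
      show "adj (Inl v) (Inr C)" using vC by (auto simp: adj_def)
      show "\<exists>b'. b' \<noteq> b \<and> adj a b'" if adj: "adj a b" for a b
      proof -
        obtain v C where e: "(v, C) \<in> E" "a = Inl v \<and> b = Inr C \<or> a = Inr C \<and> b = Inl v"
          using adj unfolding adj_def by blast
        obtain C' v' where "(v, C') \<in> E" "C' \<noteq> C" "(v', C) \<in> E" "v' \<noteq> v"
          using no e(1) unfolding has_leaf_def by blast
        then show ?thesis using e unfolding adj_def by blast
      qed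
    qed
    then obtain p where "is_cycle adj p" ..
    moreover have "inc_adj F a b" if "adj a b" for a b
      using that E(1) by (auto simp: adj_def incidences_def)
    ultimately have "is_cycle (inc_adj F) p" by (auto simp: is_cycle_def)
    then show False using assms(2) by (auto simp: acyclic_cls_def)
  qed
qed

text \<open>A variable \<open>w\<close> that occurs in only one clause \<open>C\<close> can repair
  \<open>C\<close> after the rest has been solved. The measure counts incidences with unassigned
  variables; it drops both when \<open>C\<close> is removed and when \<open>w\<close> is assigned,
  hence the induction generalises over \<open>H\<close>, \<open>A\<close> and
  \<open>f\<close>.\<close>

lemma xor_system_solvable:
  assumes "finite H" "\<And>C. C \<in> H \<Longrightarrow> clause C" "leafy H"
    and "\<And>C. C \<in> H \<Longrightarrow> card (cvars C - A) \<noteq> 1"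
    and "\<And>C. C \<in> H \<Longrightarrow> cvars C \<subseteq> A \<Longrightarrow> xsum f C = 0"
    and "v \<notin> A"
  shows "\<exists>g. (\<forall>a\<in>A. g a = f a) \<and> g v = b \<and> (\<forall>C\<in>H. xsum g C = 0)"
  using assms
proof (induction "card (incidences H - A \<times> UNIV)" arbitrary: H A f v b rule: less_induct)
  case less
  let ?E = "incidences H - A \<times> UNIV"
  have fin: "finite (cvars C)" if "C \<in> H" for C
    using less.prems(2)[OF that] by (simp add: clause_def cvars_def)
  have "incidences H = (\<Union>C\<in>H. (\<lambda>v. (v, C)) ` cvars C)" by (auto simp: incidences_def)
  then have finE: "finite ?E" using less.prems(1) fin by simp
  show ?case
  proof (cases "?E = {}")
    case True
    then have sub: "cvars C \<subseteq> A" if "C \<in> H" for C using that by (auto simp: incidences_def)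
    have "xsum (f(v := b)) C = 0" if "C \<in> H" for C
      using less.prems(5)[OF that sub[OF that]] less.prems(6) sub[OF that]
      by (subst xsum_cong[of C _ f]) auto
    then show ?thesis using less.prems(6) by (intro exI[of _ "f(v := b)"]) auto
  next
    case False
    have "has_leaf ?E" using less.prems(3) False unfolding leafy_def by blast
    then obtain w C where wC: "(w, C) \<in> ?E"
      "(\<forall>C'. (w, C') \<in> ?E \<longrightarrow> C' = C) \<or> (\<forall>w'. (w', C) \<in> ?E \<longrightarrow> w' = w)"
      unfolding has_leaf_def by blast
    then have C: "C \<in> H" and w: "w \<in> cvars C" "w \<notin> A" by (auto simp: incidences_def)
    have clC: "clause C" using less.prems(2) C by blast
    have cardC: "card (cvars C - A) \<noteq> 1" using less.prems(4) C by blast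
    have E: "(w', C') \<in> ?E" if "w' \<in> cvars C'" "w' \<notin> A" "C' \<in> H" for w' C'
      using that by (simp add: incidences_def)
    \<comment> \<open>A clause end of degree one would be a clause with a single unassigned
      variable, so the leaf is \<open>w\<close>.\<close>
    have "\<not> (\<forall>w'. (w', C) \<in> ?E \<longrightarrow> w' = w)"
    proof
      assume "\<forall>w'. (w', C) \<in> ?E \<longrightarrow> w' = w"
      then have "cvars C - A = {w}" using C w E by blast
      then show False using cardC by simp
    qed
    then have priv: "w \<notin> cvars C'" if "C' \<in> H" "C' \<noteq> C" for C'
      using wC(2) that w(2) E by blast
    have lt: "card (incidences (H - {C}) - A \<times> UNIV) < card ?E"
      using finE wC(1) by (intro psubset_card_mono) (auto simp: incidences_def)
    have IH: "\<exists>g. (\<forall>a\<in>A. g a = f a) \<and> g u = c \<and> (\<forall>C\<in>H - {C}. xsum g C = 0)"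
      if "u \<notin> A" for u c
      using less.prems that leafy_subset[OF less.prems(3), of "H - {C}"]
      by (intro less.hyps[OF lt]) auto
    have keep: "xsum (g(w := c)) C' = xsum g C'" if "C' \<in> H - {C}" for g c C'
      using priv that by (intro xsum_cong) auto
    show ?thesis
    proof (cases "w = v")
      case False
      obtain g where g: "\<forall>a\<in>A. g a = f a" "g v = b" "\<forall>C\<in>H - {C}. xsum g C = 0"
        using IH[OF less.prems(6)] by blast
      show ?thesis
      proof (cases "xsum g C = 0")
        case True
        then show ?thesis using g by blast
      next
        case n0: False
        let ?g = "g(w := \<not> g w)"
        have "xsum ?g C = 0" using n0 xsum_flip[OF clC w(1), of g] by (simp add: bit_neq_0)
        then have "\<forall>C'\<in>H. xsum ?g C' = 0" using keep g(3) by (metis DiffI singletonD)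
        then show ?thesis using g False w(2) by (intro exI[of _ ?g]) auto
      qed
    next
      case True
      \<comment> \<open>If \<open>v\<close> itself is the leaf, its value is either passed on to the only other unassigned
        variable of \<open>C\<close>, or fixing it leaves \<open>C\<close> with at least two.\<close>
      have "cvars C - A \<noteq> {w}" using cardC by auto
      then obtain u where u: "u \<in> cvars C" "u \<notin> A" "u \<noteq> w" using w by blast
      show ?thesis
      proof (cases "cvars C - A = {w, u}")
        case two: True
        let ?f = "\<lambda>c. f(w := b, u := c)"
        have "?f (\<not> f u) = (?f (f u))(u := \<not> ?f (f u) u)" by simp
        then have "xsum (?f (\<not> f u)) C = xsum (?f (f u)) C + 1"
          using xsum_flip[OF clC u(1)] by metis
        \<comment> \<open>The rest of the system is asked to give \<open>u\<close> the value
          \<open>c\<close> for which \<open>C\<close> holds once \<open>w\<close> has value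
          \<open>b\<close>.\<close>
        then obtain c where c: "xsum (?f c) C = 0"
          using bit_neq_0 by (cases "xsum (?f (f u)) C = 0") auto
        obtain g where g: "\<forall>a\<in>A. g a = f a" "g u = c" "\<forall>C\<in>H - {C}. xsum g C = 0"
          using IH[OF u(2)] by blast
        have "xsum (g(w := b)) C = xsum (?f c) C"
          using g two u(3) by (intro xsum_cong) auto
        then have "\<forall>C'\<in>H. xsum (g(w := b)) C' = 0"
          using c keep g(3) by (metis DiffI singletonD)
        then show ?thesis using g True w(2) by (intro exI[of _ "g(w := b)"]) auto
      next
        case more: False
        let ?A = "insert w A"
        have lt': "card (incidences H - ?A \<times> UNIV) < card ?E"
          using finE wC(1) by (intro psubset_card_mono) auto
        \<comment> \<open>Now \<open>v\<close> is among the assigned variables, so the induction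
          hypothesis prescribes \<open>u\<close> instead, with an arbitrary value.\<close>
        have "\<exists>g. (\<forall>a\<in>?A. g a = (f(w := b)) a) \<and> g u = True \<and> (\<forall>C\<in>H. xsum g C = 0)"
        proof (rule less.hyps[OF lt'])
          fix C' assume C': "C' \<in> H"
          show "clause C'" using less.prems(2) C' by blast
          show "card (cvars C' - ?A) \<noteq> 1"
          proof (cases "C' = C")
            case True
            obtain t where t: "t \<in> cvars C - A" "t \<noteq> w" "t \<noteq> u" using more u w by blast
            show ?thesis
            proof
              assume "card (cvars C' - ?A) = 1"
              then obtain q where q: "cvars C - ?A = {q}" using True by (metis card_1_singletonE)
              have "t \<in> cvars C - ?A" "u \<in> cvars C - ?A" using t u by simp_all
              then show False using t(3) unfolding q by simp
            qed
          next
            case False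
            then have "cvars C' - ?A = cvars C' - A" using priv C' by blast
            then show ?thesis using less.prems(4) C' by simp
          qed
          assume sub: "cvars C' \<subseteq> ?A"
          then have "C' \<noteq> C" using u by blast
          then have "w \<notin> cvars C'" using priv C' by blast
          then have "cvars C' \<subseteq> A" using sub by blast
          then show "xsum (f(w := b)) C' = 0"
            using less.prems(5) C' keep[of C'] \<open>C' \<noteq> C\<close> by simp
        qed (use less.prems u in auto)
        then obtain g where g: "\<forall>a\<in>?A. g a = (f(w := b)) a" "\<forall>C\<in>H. xsum g C = 0" by blast
        have "g a = f a" if "a \<in> A" for a using g(1) that w(2) by (metis fun_upd_other insertI2)
        moreover have "g v = b" using g(1) True by simp
        ultimately show ?thesis using g(2) by blast
      qed
    qed
  qed
qed

lemma propagated_not_forced: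
  assumes "finite H" "\<And>C. C \<in> H \<Longrightarrow> clause C" "leafy H"
    and "{} \<notin> app \<psi> (\<Union>C\<in>H. X0 C)" "\<And>x. {x} \<notin> app \<psi> (\<Union>C\<in>H. X0 C)"
  shows "\<not> forced (app \<psi> (\<Union>C\<in>H. X0 C)) x"
proof -
  let ?F = "\<Union>C\<in>H. X0 C" and ?A = "dom \<psi>"
  define f where "f v = (\<psi> v = Some True)" for v
  have ext: "extends f \<psi>" by (auto simp: extends_def f_def)
  have sub: "app \<psi> (X0 C) \<subseteq> app \<psi> ?F" if "C \<in> H" for C
    using that unfolding app_def by blast
  have C: "card (cvars C - ?A) \<noteq> 1" "cvars C \<subseteq> ?A \<Longrightarrow> xsum f C = 0" if "C \<in> H" for C
    using propagated_xor_clause[OF assms(2)[OF that] ext] sub[OF that] assms(4,5) by blast+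
  \<comment> \<open>Evaluating \<open>x\<close> with its variable set to False gives the value of
    that variable which falsifies \<open>x\<close>: False for \<open>Pos\<close>, True for
    \<open>Neg\<close>.\<close>
  define b where "b = lit_true (\<lambda>_. False) x"
  have "\<exists>g. (\<forall>a\<in>?A. g a = f a) \<and> (lvar x \<notin> ?A \<longrightarrow> g (lvar x) = b) \<and> (\<forall>C\<in>H. xsum g C = 0)"
  \<comment> \<open>The solvability lemma wants an unassigned variable. If the variable of
    \<open>x\<close> is assigned, any other one serves; if there is none at all, \<open>f\<close> is
    already a solution.\<close>
  proof (cases "?A = UNIV")
    case True
    then show ?thesis using C(2) by auto
  next
    case False
    then obtain v where v: "v \<notin> ?A" "lvar x \<notin> ?A \<Longrightarrow> v = lvar x" by blast
    then show ?thesis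
      using xor_system_solvable[OF assms(1-3) C v(1), of b] by metis
  qed
  then obtain g where g: "\<forall>a\<in>?A. g a = f a" "lvar x \<notin> ?A \<Longrightarrow> g (lvar x) = b"
    "\<forall>C\<in>H. xsum g C = 0" by blast
  have "extends g (set_lit x False ++ \<psi>)"
    unfolding extends_set_lit_map_add
  proof
    show "extends g \<psi>" using g(1) ext unfolding extends_def by (metis domI)
    show "lvar x \<notin> ?A \<longrightarrow> lit_true g x = False" using g(2) by (cases x) (auto simp: b_def)
  qed
  moreover have "models g ?F"
    using g(3) models_X0_iff assms(2) by (fastforce simp: models_def)
  ultimately show ?thesis
    unfolding forced_def app_app using satisfiable_app_iff by blast
qed

text \<open>The set \<open>V\<close> is arbitrary, which covers both the variables of
  \<open>F\<close> and those of the whole splitting.\<close>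

lemma phd_le1_leafy:
  assumes "finite H" "\<And>C. C \<in> H \<Longrightarrow> clause C" "leafy H"
  shows "phd_le1 V (\<Union>C\<in>H. X0 C)"
proof -
  let ?F = "\<Union>C\<in>H. X0 C"
  have "clause_set ?F" using assms(1,2) clause_set_X0 by (fastforce simp: clause_set_def)
  note cases = r1_app_cases[OF this]
  have "(if satisfiable (app \<phi> ?F) then \<not> (\<exists>x. lvar x \<in> V \<and> forced (r1 (app \<phi> ?F)) x)
      else r1 (app \<phi> ?F) = {{}})" for \<phi>
    using cases[of \<phi>]
  proof
    assume "\<exists>\<psi>. \<phi> \<subseteq>\<^sub>m \<psi> \<and> r1 (app \<phi> ?F) = app \<psi> ?F \<and> {} \<notin> app \<psi> ?F \<and> (\<forall>x. {x} \<notin> app \<psi> ?F)"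
    then obtain \<psi> where \<psi>: "\<phi> \<subseteq>\<^sub>m \<psi>" "r1 (app \<phi> ?F) = app \<psi> ?F" "{} \<notin> app \<psi> ?F"
      "\<And>x. {x} \<notin> app \<psi> ?F" by blast
    have nf: "\<not> forced (app \<psi> ?F) x" for x
      using propagated_not_forced[OF assms \<psi>(3,4)] .
    \<comment> \<open>Any literal will do: that it is not forced yields a model, so this case cannot
      occur for an unsatisfiable restriction.\<close>
    then obtain x where "satisfiable (app (set_lit x False ++ \<psi>) ?F)"
      by (auto simp: forced_def app_app)
    then obtain f where "extends f (set_lit x False ++ \<psi>)" "models f ?F"
      using satisfiable_app_iff by blast
    moreover from this \<psi>(1) have "extends f \<phi>"
      using extends_set_lit_map_add extends_map_le by blast
    ultimately have "satisfiable (app \<phi> ?F)" using satisfiable_app_iff by blast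
    then show ?thesis using nf \<psi>(2) by simp
  qed simp
  then show ?thesis by (simp add: phd_le1_def)
qed


subsection \<open>The natural splitting\<close>

text \<open>Literal \<open>xs ! k\<close> goes into the piece with index \<open>max 2 (k + 1)\<close>, and piece \<open>i\<close> contains the new
  variables among \<open>y (i - 1)\<close> and \<open>y i\<close>; this also covers the unsplit case of length at most two.\<close>

definition piece_lits :: "'v lit list \<Rightarrow> nat \<Rightarrow> 'v cls" where
  "piece_lits xs i = {xs ! k | k. k < length xs \<and> max 2 (Suc k) = i}"

definition piece :: "(nat \<Rightarrow> 'v) \<Rightarrow> 'v lit list \<Rightarrow> nat \<Rightarrow> 'v cls" where
  "piece y xs i = piece_lits xs i \<union> (Pos \<circ> y) ` ({i - 1, i} \<inter> {2..length xs - 1})"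

lemma nat_split_eq_pieces: "nat_split y xs = piece y xs ` {2..max 2 (length xs)}"
proof (cases "length xs \<le> 2")
  case True
  then have "piece_lits xs 2 = set xs"
    by (fastforce simp: piece_lits_def in_set_conv_nth)
  moreover have "{2..max 2 (length xs)} = {2}" "{2..length xs - 1} = {}" using True by auto
  ultimately show ?thesis using True by (simp add: nat_split_def piece_def)
next
  case False
  let ?n = "length xs"
  have "{2..max 2 ?n} = {2} \<union> {i. 3 \<le> i \<and> i \<le> ?n - 1} \<union> {?n}" using False by auto
  moreover have "piece y xs 2 = {xs ! 0, xs ! 1, Pos (y 2)}"
  proof -
    have "piece_lits xs 2 = {xs ! 0, xs ! 1}"
    proof -
      have "k < ?n \<and> max 2 (Suc k) = 2 \<longleftrightarrow> k = 0 \<or> k = 1" for k using False by auto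
      then show ?thesis unfolding piece_lits_def by auto
    qed
    moreover have "{2 - 1, 2} \<inter> {2..?n - 1} = {2}" using False by auto
    ultimately show ?thesis by (simp add: piece_def insert_commute)
  qed
  moreover have lits: "piece_lits xs i = {xs ! (i - 1)}" if "3 \<le> i" "i \<le> ?n" for i
  proof -
    have "k < ?n \<and> max 2 (Suc k) = i \<longleftrightarrow> k = i - 1" for k using that by auto
    then show ?thesis unfolding piece_lits_def by auto
  qed
  have "piece y xs i = {Pos (y (i - 1)), xs ! (i - 1), Pos (y i)}" if "3 \<le> i \<and> i \<le> ?n - 1" for i
  proof -
    have "{i - 1, i} \<inter> {2..?n - 1} = {i - 1, i}" using that by auto
    then show ?thesis using lits[of i] that by (auto simp: piece_def)
  qed
  then have "piece y xs ` {i. 3 \<le> i \<and> i \<le> ?n - 1}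
      = {{Pos (y (i - 1)), xs ! (i - 1), Pos (y i)} | i. 3 \<le> i \<and> i \<le> ?n - 1}"
    unfolding image_def by blast
  moreover have "piece y xs ?n = {Pos (y (?n - 1)), xs ! (?n - 1)}"
  proof -
    have "{?n - 1, ?n} \<inter> {2..?n - 1} = {?n - 1}" using False by auto
    then show ?thesis using lits[of ?n] False by (auto simp: piece_def)
  qed
  ultimately show ?thesis using False by (simp add: nat_split_def image_Un Let_def)
qed

lemma bit_add_eq_0_iff: "a + b + c = 0 \<longleftrightarrow> c = a + (b :: bit)"
  by (cases a; cases b; cases c) simp_all

section \<open>Pieces of the splitting and where their variables occur\<close>

locale xor_splitting =
  fixes F :: "'v cls set" and enum :: "'v cls \<Rightarrow> 'v lit list" and y :: "'v cls \<Rightarrow> nat \<Rightarrow> 'v"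
  assumes clause_set: "clause_set F"
    and literal_order: "literal_order F enum"
    and new_vars: "new_vars F y"
begin

abbreviation "last_index C \<equiv> max 2 (length (enum C))"
abbreviation "ys C \<equiv> {2..length (enum C) - 1}"
abbreviation "lits C \<equiv> piece_lits (enum C)"
abbreviation "P C \<equiv> piece (y C) (enum C)"

definition split_set :: "'v cls set" where
  "split_set = (\<Union>C\<in>F. P C ` {2..last_index C})"

lemma X1_eq: "X1 enum y F = (\<Union>D\<in>split_set. X0 D)"
  by (simp add: X1_def X1_clause_def split_set_def nat_split_eq_pieces)

lemma enum: "C \<in> F \<Longrightarrow> distinct (enum C)" "C \<in> F \<Longrightarrow> set (enum C) = C"
  using literal_order by (auto simp: literal_order_def)

lemma length_enum: "C \<in> F \<Longrightarrow> length (enum C) = card C"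
  using enum distinct_card by metis

lemma clause_F: "C \<in> F \<Longrightarrow> clause C"
  using clause_set by (simp add: clause_set_def)

lemma y_new: "C \<in> F \<Longrightarrow> j \<in> ys C \<Longrightarrow> y C j \<notin> vars F"
  using new_vars by (simp add: new_vars_def length_enum)

lemma y_inj:
  assumes "y C j = y C' j'" "C \<in> F" "C' \<in> F" "j \<in> ys C" "j' \<in> ys C'"
  shows "C = C' \<and> j = j'"
proof -
  have "inj_on (\<lambda>(C, j). y C j) (SIGMA C:F. {2..card C - 1})"
    using new_vars by (simp add: new_vars_def)
  from inj_onD[OF this, of "(C, j)" "(C', j')"] show ?thesis
    using assms by (simp add: length_enum)
qed

lemma lits_subset: "C \<in> F \<Longrightarrow> lits C i \<subseteq> C"
  using enum(2) nth_mem unfolding piece_lits_def by blast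

lemma lits_unique: "C \<in> F \<Longrightarrow> x \<in> lits C i \<Longrightarrow> x \<in> lits C j \<Longrightarrow> i = j"
  using enum(1) by (auto simp: piece_lits_def nth_eq_iff_index_eq)

lemma lits_cover:
  assumes "C \<in> F" "x \<in> C"
  shows "\<exists>i\<in>{2..last_index C}. x \<in> lits C i"
proof -
  obtain k where "k < length (enum C)" "enum C ! k = x"
    using assms enum(2) by (metis in_set_conv_nth)
  then show ?thesis
    by (intro bexI[of _ "max 2 (Suc k)"]) (auto simp: piece_lits_def)
qed

lemma cvars_lits: "C \<in> F \<Longrightarrow> cvars (lits C i) \<subseteq> cvars C" "C \<in> F \<Longrightarrow> cvars (lits C i) \<subseteq> vars F"
  using lits_subset[of C i] by (auto simp: cvars_def vars_def)

lemma cvars_piece: "cvars (P C i) = cvars (lits C i) \<union> y C ` ({i - 1, i} \<inter> ys C)"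
  by (simp add: piece_def cvars_def image_Un image_image)

lemma clause_piece:
  assumes "C \<in> F"
  shows "clause (P C i)"
proof -
  have "finite (lits C i)"
    using lits_subset[OF assms] clause_F[OF assms] by (auto simp: clause_def intro: finite_subset)
  moreover have "compl x \<notin> P C i" if "x \<in> P C i" for x
  proof
    assume "compl x \<in> P C i"
    moreover have "lvar z \<notin> vars F" if "z \<in> (Pos \<circ> y C) ` ({i - 1, i} \<inter> ys C)" for z
      using that y_new[OF assms] by auto
    moreover have "lvar z \<in> vars F" if "z \<in> lits C i" for z
      using that cvars_lits(2)[OF assms] by (auto simp: cvars_def)
    moreover have "lvar (compl x) = lvar x" by (cases x) auto
    \<comment> \<open>Old and new variables are disjoint, so a complementary pair would lie among
      the literals of \<open>C\<close> or among the new literals, all of which are positive.\<close>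
    ultimately have "x \<in> lits C i \<and> compl x \<in> lits C i \<or>
        x \<in> (Pos \<circ> y C) ` ({i - 1, i} \<inter> ys C) \<and> compl x \<in> (Pos \<circ> y C) ` ({i - 1, i} \<inter> ys C)"
      using \<open>x \<in> P C i\<close> unfolding piece_def by (metis UnE)
    then show False
      using lits_subset[OF assms, of i] clause_F[OF assms] unfolding clause_def by auto
  qed
  ultimately show ?thesis by (simp add: clause_def piece_def)
qed

lemma piece_in_split_set: "C \<in> F \<Longrightarrow> i \<in> {2..last_index C} \<Longrightarrow> P C i \<in> split_set"
  unfolding split_set_def by blast

lemma split_incidence:
  assumes "E \<subseteq> incidences split_set" "(v, D) \<in> E"
  shows "\<exists>C\<in>F. \<exists>i\<in>{2..last_index C}. D = P C i \<and> v \<in> cvars D"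
  using assms unfolding incidences_def split_set_def by blast

lemma finite_split_set: "finite split_set"
  using clause_set by (simp add: split_set_def clause_set_def)

lemma clause_split_set: "D \<in> split_set \<Longrightarrow> clause D"
  using clause_piece by (auto simp: split_set_def)

lemma old_var_piece:
  assumes "C \<in> F" "v \<in> cvars (P C i)" "v \<in> vars F"
  shows "v \<in> cvars (lits C i)"
  using assms y_new by (auto simp: cvars_piece)

lemma old_var_unique:
  assumes "C \<in> F" "v \<in> cvars (lits C i)" "v \<in> cvars (lits C j)"
  shows "i = j"
proof -
  obtain x z where xz: "x \<in> lits C i" "z \<in> lits C j" "lvar x = v" "lvar z = v"
    using assms by (auto simp: cvars_def)
  then have "x = z"
    using clause_lit_unique[OF clause_F[OF assms(1)]] lits_subset[OF assms(1)] by blast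
  then show ?thesis using xz lits_unique[OF assms(1)] by blast
qed

lemma new_var_piece:
  assumes "C \<in> F" "C' \<in> F" "j \<in> ys C" "y C j \<in> cvars (P C' i)"
  shows "C' = C \<and> (i = j \<or> i = Suc j)"
proof -
  have "y C j \<notin> cvars (lits C' i)" using y_new cvars_lits(2) assms by blast
  then obtain j' where "j' \<in> {i - 1, i} \<inter> ys C'" "y C j = y C' j'"
    using assms(4) unfolding cvars_piece by blast
  then show ?thesis using y_inj assms(1-3) by fastforce
qed

text \<open>The pieces of \<open>C\<close> form a path linked by the new variables, so in an edge set without leaves
  each of the two ends of the occurring part of the path has to contribute an old variable.\<close>

lemma two_old_vars:
  assumes E: "E \<subseteq> incidences split_set" "\<not> has_leaf E"
    and C: "C \<in> F" and i0: "i0 \<in> {2..last_index C}" "(v0, P C i0) \<in> E"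
  shows "\<exists>a b i j. a \<noteq> b \<and> i \<in> {2..last_index C} \<and> j \<in> {2..last_index C} \<and> a \<in> cvars (lits C i) \<and>
    b \<in> cvars (lits C j) \<and> (a, P C i) \<in> E \<and> (b, P C j) \<in> E"
proof -
  define I where "I = {i \<in> {2..last_index C}. \<exists>v. (v, P C i) \<in> E}"
  have I: "finite I" "I \<noteq> {}" using i0 by (auto simp: I_def)
  define lo hi where "lo = Min I" and "hi = Max I"
  have lo: "lo \<in> I" "\<And>i. i \<in> I \<Longrightarrow> lo \<le> i" and hi: "hi \<in> I" "\<And>i. i \<in> I \<Longrightarrow> i \<le> hi"
    using I by (auto simp: lo_def hi_def)
  have mem: "v \<in> cvars (lits C i) \<or> v \<in> y C ` ({i - 1, i} \<inter> ys C)" if "(v, P C i) \<in> E" for v i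
    using that E(1) by (auto simp: incidences_def cvars_piece)
  \<comment> \<open>A new variable needs a second edge in \<open>E\<close>, and only the
    neighbouring piece can provide it.\<close>
  have link: "\<exists>i'\<in>I. i' \<noteq> i \<and> (i' = j \<or> i' = Suc j)" if j: "(y C j, P C i) \<in> E" "j \<in> ys C" for i j
  proof -
    obtain D where D: "(y C j, D) \<in> E" "D \<noteq> P C i"
      using E(2) j(1) unfolding has_leaf_def by blast
    then obtain C' i' where D': "C' \<in> F" "i' \<in> {2..last_index C'}" "D = P C' i'" "y C j \<in> cvars D"
      using split_incidence[OF E(1)] by blast
    then have "C' = C" "i' = j \<or> i' = Suc j" using new_var_piece[OF C D'(1) j(2)] by blast+
    moreover from this have "i' \<in> I" "i' \<noteq> i" using D D' unfolding I_def by auto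
    ultimately show ?thesis by blast
  qed
  have two: "\<exists>v v'. v \<noteq> v' \<and> (v, P C i) \<in> E \<and> (v', P C i) \<in> E" if "i \<in> I" for i
    using that E(2) unfolding I_def has_leaf_def by blast
  \<comment> \<open>The second edge of \<open>y C (lo - 1)\<close> would lead to a piece below the
    minimum; that of \<open>y C hi\<close> to one above the maximum.\<close>
  have below: "(y C j, P C lo) \<notin> E" if "j \<in> ys C" "j = lo - 1" for j
    using link[of j lo] lo that by fastforce
  have above: "(y C j, P C hi) \<notin> E" if "j \<in> ys C" "j = hi" for j
    using link[of j hi] hi that by fastforce
  obtain v v' where v: "v \<noteq> v'" "(v, P C lo) \<in> E" "(v', P C lo) \<in> E" using two lo by blast
  obtain w w' where w: "w \<noteq> w'" "(w, P C hi) \<in> E" "(w', P C hi) \<in> E" using two hi by blast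
  have v_lo: "u \<in> cvars (lits C lo) \<or> u = y C lo \<and> lo \<in> ys C" if "(u, P C lo) \<in> E" for u
    using mem[OF that] below that by auto
  have w_hi: "u \<in> cvars (lits C hi) \<or> u = y C (hi - 1)" if "(u, P C hi) \<in> E" for u
    using mem[OF that] above that by auto
  have idx: "lo \<in> {2..last_index C}" "hi \<in> {2..last_index C}" using lo hi by (auto simp: I_def)
  show ?thesis
  \<comment> \<open>A single piece loses both its new variables, so its two edges are old. Otherwise
    each end keeps at most one new variable and one of its two edges is old; the two old variables
    differ because a variable of \<open>C\<close> lies in one piece only.\<close>
  proof (cases "lo = hi")
    case True
    then have "v \<in> cvars (lits C lo)" "v' \<in> cvars (lits C lo)"
      using v v_lo above by blast+
    then show ?thesis using v idx by blast
  next
    case False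
    obtain a where a: "a \<in> cvars (lits C lo)" "(a, P C lo) \<in> E" using v v_lo by metis
    obtain b where b: "b \<in> cvars (lits C hi)" "(b, P C hi) \<in> E" using w w_hi by metis
    have "a \<noteq> b" using old_var_unique[OF C] a b False by blast
    then show ?thesis using a b idx by blast
  qed
qed

text \<open>Contracting the pieces of each clause turns an edge set without leaf into the set
  \<open>E'\<close> of old incidences of \<open>F\<close>, again without leaf.\<close>

lemma leafy_split_set:
  assumes "leafy F"
  shows "leafy split_set"
  unfolding leafy_def
proof (intro allI impI, rule ccontr)
  fix E assume E: "E \<subseteq> incidences split_set" "E \<noteq> {}" "\<not> has_leaf E"
  define E' where "E' = {(v, C). C \<in> F \<and> (\<exists>i\<in>{2..last_index C}. v \<in> cvars (lits C i) \<and> (v, P C i) \<in> E)}"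
  note mem = split_incidence[OF E(1)]
  have "E' \<subseteq> incidences F"
    using cvars_lits(1) by (auto simp: E'_def incidences_def)
  moreover have "E' \<noteq> {}"
  proof -
    obtain v D where "(v, D) \<in> E" using E(2) by auto
    then obtain C i where "C \<in> F" "i \<in> {2..last_index C}" "(v, P C i) \<in> E" using mem by blast
    from two_old_vars[OF E(1,3) this] show ?thesis using \<open>C \<in> F\<close> unfolding E'_def by blast
  qed
  ultimately have "has_leaf E'" using assms unfolding leafy_def by blast
  then obtain v C where vC: "(v, C) \<in> E'"
    and leaf: "(\<forall>C'. (v, C') \<in> E' \<longrightarrow> C' = C) \<or> (\<forall>v'. (v', C) \<in> E' \<longrightarrow> v' = v)"
    unfolding has_leaf_def by blast
  then obtain i where C: "C \<in> F" and i: "i \<in> {2..last_index C}" "v \<in> cvars (lits C i)" "(v, P C i) \<in> E"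
    unfolding E'_def by blast
  from leaf show False
  proof
    assume only: "\<forall>C'. (v, C') \<in> E' \<longrightarrow> C' = C"
    obtain D where D: "(v, D) \<in> E" "D \<noteq> P C i"
      using E(3) i(3) unfolding has_leaf_def by blast
    then obtain C' i' where D': "C' \<in> F" "i' \<in> {2..last_index C'}" "D = P C' i'" "v \<in> cvars D"
      using mem by blast
    \<comment> \<open>An old variable lies in just one piece of \<open>C\<close>, so its second edge
      belongs to another clause and survives the contraction.\<close>
    then have v': "v \<in> cvars (lits C' i')"
      using old_var_piece cvars_lits(2)[OF C] i(2) by blast
    then have "(v, C') \<in> E'" using D D' unfolding E'_def by blast
    then have "C' = C" using only by blast
    then show False using old_var_unique[OF C i(2)] v' D(2) D'(3) by blast
  next
    assume "\<forall>v'. (v', C) \<in> E' \<longrightarrow> v' = v"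
    then show False
      using two_old_vars[OF E(1,3) C i(1,3)] C unfolding E'_def by blast
  qed
qed

text \<open>The value 0 outside \<open>ys C\<close> stands for the missing new variables at both
  ends of the path, so every piece obeys the same equation.\<close>

definition y_bit :: "('v \<Rightarrow> bool) \<Rightarrow> 'v cls \<Rightarrow> nat \<Rightarrow> bit" where
  "y_bit g C j = (if j \<in> ys C then of_bool (g (y C j)) else 0)"

text \<open>The first \<open>i\<close> literals of \<open>C\<close>, capped at the length, for
  \<open>i\<close> at least 2; empty for smaller \<open>i\<close>, as piece 2 takes two literals at
  once.\<close>

definition initial_lits :: "'v cls \<Rightarrow> nat \<Rightarrow> 'v cls" where
  "initial_lits C i = (\<Union>j\<in>{2..i}. lits C j)"

lemma xsum_piece:
  assumes "C \<in> F" "2 \<le> i"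
  shows "xsum g (P C i) = y_bit g C (i - 1) + xsum g (lits C i) + y_bit g C i"
proof -
  let ?J = "{i - 1, i} \<inter> ys C"
  have "lits C i \<inter> (Pos \<circ> y C) ` ?J = {}"
    using cvars_lits(2)[OF assms(1)] y_new[OF assms(1)] by (force simp: cvars_def)
  moreover have "finite (lits C i)"
    using lits_subset[OF assms(1)] clause_F[OF assms(1)] by (auto simp: clause_def intro: finite_subset)
  ultimately have "xsum g (P C i) = xsum g (lits C i) + xsum g ((Pos \<circ> y C) ` ?J)"
    unfolding xsum_def piece_def by (intro sum.union_disjoint) auto
  also have "xsum g ((Pos \<circ> y C) ` ?J) = (\<Sum>j\<in>?J. of_bool (g (y C j)))"
  proof -
    have "inj_on (Pos \<circ> y C) ?J" using y_inj assms(1) by (auto simp: inj_on_def)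
    then have "xsum g ((Pos \<circ> y C) ` ?J) = sum ((\<lambda>x. of_bool (lit_true g x)) \<circ> (Pos \<circ> y C)) ?J"
      unfolding xsum_def by (rule sum.reindex)
    then show ?thesis by (simp only: comp_def lit_true.simps)
  qed
  also have "\<dots> = (\<Sum>j\<in>{i - 1, i}. y_bit g C j)"
    unfolding y_bit_def by (rule sum.inter_restrict) simp
  also have "\<dots> = y_bit g C (i - 1) + y_bit g C i" using assms(2) by simp
  finally show ?thesis by (simp only: add_ac)
qed

lemma xsum_initial_lits_Suc:
  assumes "C \<in> F" "1 \<le> i"
  shows "xsum g (initial_lits C (Suc i)) = xsum g (initial_lits C i) + xsum g (lits C (Suc i))"
proof -
  have "initial_lits C (Suc i) = initial_lits C i \<union> lits C (Suc i)"
    using assms(2) by (auto simp: initial_lits_def atLeastAtMostSuc_conv)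
  moreover have "initial_lits C i \<inter> lits C (Suc i) = {}"
    using lits_unique[OF assms(1)] by (fastforce simp: initial_lits_def)
  moreover have "finite (lits C j)" for j
    using lits_subset[OF assms(1)] clause_F[OF assms(1)] by (auto simp: clause_def intro: finite_subset)
  ultimately show ?thesis
    unfolding xsum_def by (simp only:) (intro sum.union_disjoint, auto simp: initial_lits_def)
qed

lemma initial_lits_1: "initial_lits C (Suc 0) = {}"
  by (simp add: initial_lits_def)

lemma initial_lits_top:
  assumes "C \<in> F"
  shows "initial_lits C (last_index C) = C"
proof
  show "initial_lits C (last_index C) \<subseteq> C"
    unfolding initial_lits_def by (intro UN_least lits_subset[OF assms])
  show "C \<subseteq> initial_lits C (last_index C)"
    using lits_cover[OF assms] by (auto simp only: initial_lits_def UN_iff)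
qed

text \<open>Modulo 2, piece \<open>i\<close> says that the new bit at \<open>i\<close> is the bit at
  \<open>i - 1\<close> plus the literals of the piece. Starting from 0 at index 1, the new bits are
  therefore the prefix sums.\<close>

lemma pieces_zero_iff:
  assumes "C \<in> F"
  shows "(\<forall>i\<in>{2..last_index C}. xsum g (P C i) = 0) \<longleftrightarrow>
    (\<forall>i\<in>{1..last_index C}. y_bit g C i = xsum g (initial_lits C i))" (is "?L \<longleftrightarrow> ?R")
proof
  assume L: ?L
  have "i \<le> last_index C \<Longrightarrow> y_bit g C i = xsum g (initial_lits C i)" if "1 \<le> i" for i
    using that
  proof (induction i rule: dec_induct)
    case base
    show ?case by (simp add: y_bit_def initial_lits_1 xsum_def)
  next
    case (step i)
    then have "xsum g (P C (Suc i)) = 0" using L by simp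
    then have "y_bit g C (Suc i) = y_bit g C i + xsum g (lits C (Suc i))"
      using xsum_piece[OF assms, of "Suc i" g] step(1) bit_add_eq_0_iff by auto
    then show ?case
      using step xsum_initial_lits_Suc[OF assms step(1)] by (simp only: Suc_leD)
  qed
  then show ?R by simp
next
  assume R: ?R
  show ?L
  proof
    fix i assume i: "i \<in> {2..last_index C}"
    then obtain k where k: "i = Suc k" "1 \<le> k" by (cases i) auto
    then have "y_bit g C i = y_bit g C k + xsum g (lits C i)"
      using R i xsum_initial_lits_Suc[OF assms k(2)] by (metis Suc_leD atLeastAtMost_iff le_SucI)
    then show "xsum g (P C i) = 0"
      using xsum_piece[OF assms, of i g] i k(1) by (simp only: bit_add_eq_0_iff diff_Suc_1 atLeastAtMost_iff)
  qed
qed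

lemma split_set_zero_iff:
  "(\<forall>D\<in>split_set. xsum g D = 0) \<longleftrightarrow> (\<forall>C\<in>F. \<forall>i\<in>{2..last_index C}. xsum g (P C i) = 0)"
  by (auto simp: split_set_def)

lemma y_bit_top: "y_bit g C (last_index C) = 0"
  by (auto simp: y_bit_def)

text \<open>At the last index the bit is 0 and the prefix is all of \<open>C\<close>.\<close>

lemma split_set_zero_imp:
  assumes "\<forall>D\<in>split_set. xsum g D = 0" "C \<in> F"
  shows "xsum g C = 0"
proof -
  have "y_bit g C (last_index C) = xsum g (initial_lits C (last_index C))"
    using assms pieces_zero_iff[of C g] split_set_zero_iff by simp
  then show ?thesis by (simp only: y_bit_top initial_lits_top[OF assms(2)])
qed

lemma ex_split_set_zero:
  assumes "\<forall>C\<in>F. xsum f C = 0"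
  shows "\<exists>g. (\<forall>v\<in>vars F. g v = f v) \<and> (\<forall>D\<in>split_set. xsum g D = 0)"
proof -
  \<comment> \<open>The new variables have no choice but to be prefix sums; they are distinct and
    outside \<open>vars F\<close>, so this is well defined.\<close>
  define g where "g v = (if v \<in> vars F then f v
    else \<exists>C\<in>F. \<exists>j\<in>ys C. v = y C j \<and> xsum f (initial_lits C j) = 1)" for v
  have y: "g (y C j) \<longleftrightarrow> xsum f (initial_lits C j) = 1" if "C \<in> F" "j \<in> ys C" for C j
    using that y_new y_inj unfolding g_def by metis
  have init: "xsum g (initial_lits C i) = xsum f (initial_lits C i)" if "C \<in> F" for C i
    using cvars_lits(2)[OF that] by (intro xsum_cong) (force simp: g_def initial_lits_def cvars_def)
  have "y_bit g C i = xsum g (initial_lits C i)" if C: "C \<in> F" and i: "i \<in> {1..last_index C}" for C i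
  proof -
    \<comment> \<open>Outside \<open>ys C\<close> only the two ends remain: an empty prefix at 1,
      and all of \<open>C\<close>, with sum 0 by assumption, at the last index.\<close>
    consider "i \<in> ys C" | "i \<notin> ys C" "i = 1" | "i \<notin> ys C" "i = last_index C" using i by fastforce
    then show ?thesis
    proof cases
      case 1
      then show ?thesis
        unfolding init[OF C] using y[OF C 1] bit_neq_0 by (auto simp: y_bit_def)
    next
      case 2
      then show ?thesis by (simp add: y_bit_def initial_lits_1 xsum_def)
    next
      case 3
      then show ?thesis
        unfolding init[OF C] using assms C by (simp only: y_bit_top initial_lits_top)
    qed
  qed
  then have "\<forall>D\<in>split_set. xsum g D = 0"
    unfolding split_set_zero_iff using pieces_zero_iff by blast
  moreover have "\<forall>v\<in>vars F. g v = f v" by (simp add: g_def)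
  ultimately show ?thesis by blast
qed

section \<open>Representation of \<open>F\<close>, and propagation from total assignments\<close>

lemma models_X1_iff: "models f (X1 enum y F) \<longleftrightarrow> (\<forall>D\<in>split_set. xsum f D = 0)"
proof -
  have "models f (X1 enum y F) \<longleftrightarrow> (\<forall>D\<in>split_set. models f (X0 D))"
    unfolding X1_eq models_def by blast
  then show ?thesis using models_X0_iff clause_split_set by blast
qed

lemma clause_set_X1: "clause_set (X1 enum y F)"
  unfolding X1_eq using finite_split_set clause_set_X0 clause_split_set
  by (auto simp: clause_set_def)

lemma vars_subset_X1: "vars F \<subseteq> vars (X1 enum y F)"
proof
  fix v assume "v \<in> vars F"
  then obtain C x where C: "C \<in> F" "x \<in> C" "lvar x = v" by (auto simp: vars_def cvars_def)
  then obtain i where "i \<in> {2..last_index C}" "x \<in> lits C i" using lits_cover by blast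
  then have "P C i \<in> split_set" "v \<in> cvars (P C i)"
    using C piece_in_split_set by (auto simp: piece_def cvars_def)
  then have "v \<in> vars (X0 (P C i))" using vars_X0 clause_split_set by blast
  then show "v \<in> vars (X1 enum y F)"
    using \<open>P C i \<in> split_set\<close> unfolding X1_eq vars_def by blast
qed

lemma cnf_representation_X1: "cnf_representation F (X1 enum y F)"
proof -
  have "satisfiable (app \<phi> (X1 enum y F)) \<longleftrightarrow> xor_sat \<phi> F" if dom: "dom \<phi> = vars F" for \<phi>
  proof -
    have xor: "xor_sat \<phi> F \<longleftrightarrow> (\<forall>C\<in>F. xsum f C = 0)" if f: "extends f \<phi>" for f
    proof -
      have "(\<Sum>x\<in>C. of_bool (lit_val \<phi> x = Some True)) = xsum f C" if "C \<in> F" for C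
        unfolding xsum_def
      proof (intro sum.cong refl)
        fix x assume "x \<in> C"
        then have "lvar x \<in> dom \<phi>" using \<open>C \<in> F\<close> dom by (auto simp: vars_def cvars_def)
        then show "of_bool (lit_val \<phi> x = Some True) = (of_bool (lit_true f x) :: bit)"
          using lit_val_extends[OF f] by simp
      qed
      then show ?thesis by (simp add: xor_sat_def)
    qed
    show ?thesis
      unfolding satisfiable_app_iff models_X1_iff
    proof
      assume "\<exists>f. extends f \<phi> \<and> (\<forall>D\<in>split_set. xsum f D = 0)"
      then show "xor_sat \<phi> F" using xor split_set_zero_imp by blast
    next
      assume sat: "xor_sat \<phi> F"
      define f where "f v = (\<phi> v = Some True)" for v
      have f: "extends f \<phi>" by (auto simp: extends_def f_def)
      then have "\<forall>C\<in>F. xsum f C = 0" using sat xor by simp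
      from ex_split_set_zero[OF this]
      obtain g where "\<forall>v\<in>vars F. g v = f v" "\<forall>D\<in>split_set. xsum g D = 0" by blast
      moreover from this have "extends g \<phi>"
        using f dom unfolding extends_def by (metis domI)
      ultimately show "\<exists>f. extends f \<phi> \<and> (\<forall>D\<in>split_set. xsum f D = 0)" by blast
    qed
  qed
  then show ?thesis
    using clause_set_X1 vars_subset_X1 by (simp add: cnf_representation_def)
qed

text \<open>Once the preceding new variable is assigned, at most the next one is unassigned in the
  piece they share, and exactly one is excluded.\<close>

lemma new_vars_propagated:
  assumes "vars F \<subseteq> A" "\<And>D. D \<in> split_set \<Longrightarrow> card (cvars D - A) \<noteq> 1" "D \<in> split_set"
  shows "cvars D \<subseteq> A"
proof -
  obtain C i where C: "C \<in> F" and i: "D = P C i" using assms(3) by (auto simp: split_set_def)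
  \<comment> \<open>Indices outside \<open>ys C\<close> hold vacuously, so the first piece needs no
    separate treatment.\<close>
  have "j \<in> ys C \<longrightarrow> y C j \<in> A" for j
  proof (induction j)
    case (Suc j)
    show ?case
    proof
      assume j: "Suc j \<in> ys C"
      have sub: "cvars (P C (Suc j)) - A \<subseteq> {y C (Suc j)}"
        using Suc cvars_lits(2)[OF C] assms(1) unfolding cvars_piece by auto
      have "y C (Suc j) \<in> cvars (P C (Suc j))" using j by (auto simp: cvars_piece)
      moreover have "P C (Suc j) \<in> split_set" using C j by (intro piece_in_split_set) auto
      then have "cvars (P C (Suc j)) - A \<noteq> {y C (Suc j)}" using assms(2) by fastforce
      ultimately show "y C (Suc j) \<in> A" using sub by blast
    qed
  qed simp
  then show ?thesis
    using cvars_lits(2)[OF C] assms(1) unfolding i cvars_piece by blast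
qed

lemma r1_total:
  assumes "dom \<phi> = vars F" "satisfiable (app \<phi> (X1 enum y F))"
  shows "r1 (app \<phi> (X1 enum y F)) = {}"
proof -
  let ?F = "X1 enum y F"
  obtain \<psi> where \<psi>: "\<phi> \<subseteq>\<^sub>m \<psi>" "r1 (app \<phi> ?F) = app \<psi> ?F" "{} \<notin> app \<psi> ?F"
    "\<And>x. {x} \<notin> app \<psi> ?F"
    using r1_app_cases[OF clause_set_X1, of \<phi>] assms(2) by blast
  define f where "f v = (\<psi> v = Some True)" for v
  have ext: "extends f \<psi>" by (auto simp: extends_def f_def)
  have D: "card (cvars D - dom \<psi>) \<noteq> 1" "cvars D \<subseteq> dom \<psi> \<Longrightarrow> xsum f D = 0"
    if "D \<in> split_set" for D
  proof -
    have "app \<psi> (X0 D) \<subseteq> app \<psi> ?F" using that unfolding X1_eq app_def by blast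
    then show "card (cvars D - dom \<psi>) \<noteq> 1" "cvars D \<subseteq> dom \<psi> \<Longrightarrow> xsum f D = 0"
      using propagated_xor_clause[OF clause_split_set[OF that] ext] \<psi>(3,4) by blast+
  qed
  have "vars F \<subseteq> dom \<psi>" using map_le_implies_dom_le[OF \<psi>(1)] assms(1) by simp
  then have sub: "cvars D \<subseteq> dom \<psi>" if "D \<in> split_set" for D
    using new_vars_propagated D(1) that by blast
  then have f: "models f ?F" using D(2) models_X1_iff by blast
  \<comment> \<open>Propagation has assigned every variable of every piece, so a literal true under
    \<open>f\<close> is true under \<open>\<psi>\<close> and removes its clause.\<close>
  have "\<exists>x\<in>K. lit_val \<psi> x = Some True" if K: "K \<in> ?F" for K
  proof -
    obtain x where x: "x \<in> K" "lit_true f x" using f K by (auto simp: models_def)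
    obtain D where "D \<in> split_set" "K \<in> X0 D" using K unfolding X1_eq by blast
    moreover have "lvar x \<in> cvars K" using x(1) by (simp add: cvars_def)
    ultimately have "lvar x \<in> dom \<psi>" using sub unfolding X0_def by blast
    then have "lit_val \<psi> x = Some True" using lit_val_extends[OF ext] x(2) by simp
    then show ?thesis using x(1) by blast
  qed
  then have "app \<psi> ?F = {}" unfolding app_def by blast
  then show ?thesis using \<psi>(2) by simp
qed

end

theorem theorem9p7:
  fixes F :: "'v cls set"
    and enum :: "'v cls \<Rightarrow> 'v lit list"
    and y :: "'v cls \<Rightarrow> nat \<Rightarrow> 'v"
  assumes "clause_set F"
    and "acyclic_cls F"
    and "literal_order F enum"
    and "new_vars F y"
  shows "absolute_forcing_representation F (X1 enum y F)"
proof -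
  interpret xor_splitting F enum y by unfold_locales (use assms in auto)
  have "leafy split_set" using acyclic_imp_leafy assms(1,2) leafy_split_set by blast
  then have "phd_le1 V (X1 enum y F)" for V
    unfolding X1_eq using phd_le1_leafy finite_split_set clause_split_set by blast
  then show ?thesis
    using cnf_representation_X1 r1_total clause_set_X1
    by (auto simp: absolute_forcing_representation_def forcing_representation_def PC_def)
qed

end
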